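(* Let $\Psi$ be a set of atomic propositions. The logic $\mathrm{RSOL}$ is complete with respect to $\mathrm{SOL}$: for all terms $t,u\in\mathcal L_\Psi$, $$ \vdash_{\mathrm{SOL}} t\leq u \ \Rightarrow\ \vdash_{\mathrm{RSOL}} t\leq u .$$
   Context: A bounded orthoposet $\langle P,\leq,{}^\bot\rangle$ is a partially ordered set with least element $0$ and greatest element $1$ and an orthocomplementation $a\mapsto a^\bot$, i.e. an order-reversing involution ($a\le b\Rightarrow b^\bot\le a^\bot$, $a^{\bot\bot}=a$) such that for every $a$ the meet of $a$ and $a^\bot$ exists and is $0$, and their join exists and is $1$. A Sasaki orthoposet is a tuple $\langle P,\leq,{}^\bot,\&\rangle$ where $\langle P,\leq,{}^\bot\rangle$ is a bounded orthoposet and $\&:P^2\to P$ is a total binary operation such that for all $a,b,c\in P$: (L-Monotony) $a\le b \Rightarrow a\,\&\,c\le b\,\&\,c$; (R-Reduction) $a\,\&\,b\le b$; (Orthomodularity) $a\le b\Rightarrow a=a\,\&\,b$; (Galois) $a\,\&\,b\le c\Rightarrow c^\bot\,\&\,b\le a^\bot$. Terms: $\mathcal L_\Psi$ is the set of terms generated by the grammar $t ::= p \mid t\,\&\,t \mid t^\bot$ with $p\in\Psi$ (purely syntactic; $t^{\bot\bot}$ is a different term from $t$). Semantics ($\mathrm{SOL}$): a $\Psi$-Sasaki model $\mathcal M$ is a Sasaki orthoposet $\langle P,\leq_P,{}^{\bot_P},\&_P\rangle$ together with a function $\nu:\Psi\to P$. The interpretation $[\![\cdot]\!]_{\mathcal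 M}:\mathcal L_\Psi\to P$ is defined inductively by $[\![p]\!]_{\mathcal M}=\nu(p)$ for $p\in\Psi$, $[\![t^\bot]\!]_{\mathcal M}=([\![t]\!]_{\mathcal M})^{\bot_P}$, $[\![t_1\,\&\,t_2]\!]_{\mathcal M}=[\![t_1]\!]_{\mathcal M}\,\&_P\,[\![t_2]\!]_{\mathcal M}$. One writes $\vdash_{\mathrm{SOL}} t_1\leq t_2$ iff $[\![t_1]\!]_{\mathcal M}\leq_P[\![t_2]\!]_{\mathcal M}$ for every $\Psi$-Sasaki model $\mathcal M$. Rules ($\mathrm{RSOL}$): $\vdash_{\mathrm{RSOL}} a\leq b$ means the formal inequality $a\le b$ is derivable by finite proof trees from the following rules, for arbitrary terms $a,b,c,d\in\mathcal L_\Psi$: ($A$) infer $a\leq a$ (no premise); ($S$) from $b^\bot\leq a^\bot$ infer $a\leq b$; ($G$) from $c^\bot\,\&\,b\leq a^\bot$ infer $a\,\&\,b\leq c$; ($N_L$) from $a\leq b$ infer $a^{\bot\bot}\leq b$; ($N_R$) from $a\leq b$ infer $a\leq b^{\bot\bot}$; ($T$) from $a\leq b$ and $b\leq c$ infer $a\leq c$; ($O_L$) from $a\leq b$ and $a\leq c$ infer $a\,\&\,b\leq c$; ($O_R$) from $a\leq b$ and $a\leq c$ infer $a\leq b\,\&\,c$; ($R$) from $b\leq c$ infer $a\,\&\,b\leq c$; ($M$) from $a\leq c$, $b\leq d$ and $d\leq b$ infer $a\,\&\,b\leq c\,\&\,d$. *)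

theory Defs
  imports "HOL-Algebra.Order"
begin

section \<open>Sasaki orthoposets\<close>

record 'a orthoposet = "'a gorder" +
  perp :: "'a \<Rightarrow> 'a" (\<open>\<sim>\<index> _\<close> [81] 80)

locale bounded_orthoposet =
    partial_order L + weak_partial_order_bottom L + weak_partial_order_top L
    for L (structure) +
  assumes perp_closed: "a \<in> carrier L \<Longrightarrow> \<sim> a \<in> carrier L"
    and perp_antimono: "\<lbrakk>a \<in> carrier L; b \<in> carrier L; a \<sqsubseteq> b\<rbrakk> \<Longrightarrow> \<sim> b \<sqsubseteq> \<sim> a"
    and perp_perp: "a \<in> carrier L \<Longrightarrow> \<sim> (\<sim> a) = a"
    and perp_meet: "a \<in> carrier L \<Longrightarrow> is_glb L \<bottom> {a, \<sim> a}"
    and perp_join: "a \<in> carrier L \<Longrightarrow> is_lub L \<top> {a, \<sim> a}"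

record 'a sasaki = "'a orthoposet" +
  sand :: "'a \<Rightarrow> 'a \<Rightarrow> 'a" (infixl \<open>\<odot>\<index>\<close> 70)

locale sasaki_orthoposet = bounded_orthoposet L for L (structure) +
  assumes sand_closed: "\<lbrakk>a \<in> carrier L; b \<in> carrier L\<rbrakk> \<Longrightarrow> a \<odot> b \<in> carrier L"
    and L_Monotony:
      "\<lbrakk>a \<in> carrier L; b \<in> carrier L; c \<in> carrier L; a \<sqsubseteq> b\<rbrakk> \<Longrightarrow> a \<odot> c \<sqsubseteq> b \<odot> c"
    and R_Reduction: "\<lbrakk>a \<in> carrier L; b \<in> carrier L\<rbrakk> \<Longrightarrow> a \<odot> b \<sqsubseteq> b"
    and Orthomodularity: "\<lbrakk>a \<in> carrier L; b \<in> carrier L; a \<sqsubseteq> b\<rbrakk> \<Longrightarrow> a = a \<odot> b"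
    and Galois:
      "\<lbrakk>a \<in> carrier L; b \<in> carrier L; c \<in> carrier L; a \<odot> b \<sqsubseteq> c\<rbrakk> \<Longrightarrow> \<sim> c \<odot> b \<sqsubseteq> \<sim> a"


section \<open>Terms and semantics\<close>

text \<open>The set of atomic propositions is the type \<^typ>\<open>'p\<close>.\<close>

datatype 'p trm =
    Atom 'p
  | SAnd "'p trm" "'p trm" (infixl \<open>\<^bold>&\<close> 70)
  | Perp "'p trm" (\<open>_\<^sup>\<bottom>\<close> [999] 999)

primrec interp :: "('a, 'b) sasaki_scheme \<Rightarrow> ('p \<Rightarrow> 'a) \<Rightarrow> 'p trm \<Rightarrow> 'a" where
  "interp M \<nu> (Atom p) = \<nu> p"
| "interp M \<nu> (t \<^bold>& u) = interp M \<nu> t \<odot>\<^bsub>M\<^esub> interp M \<nu> u"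
| "interp M \<nu> (t\<^sup>\<bottom>) = \<sim>\<^bsub>M\<^esub> (interp M \<nu> t)"

definition sasaki_model :: "'a sasaki \<Rightarrow> ('p \<Rightarrow> 'a) \<Rightarrow> bool" where
  "sasaki_model M \<nu> \<longleftrightarrow> sasaki_orthoposet M \<and> \<nu> \<in> UNIV \<rightarrow> carrier M"

text \<open>
  A formula of HOL cannot quantify over all types, so validity is first defined for the
  models whose carrier is a subset of a given type \<^typ>\<open>'a\<close>, and then for the type
  \<^typ>\<open>'p trm set\<close>. No generality is lost: by \<open>SOL_valid_in_all_types\<close> below, a
  \<open>SOL\<close>-valid inequality holds in the models over every type.
\<close>

definition valid_in :: "'a itself \<Rightarrow> 'p trm \<Rightarrow> 'p trm \<Rightarrow> bool" where
  "valid_in TYPE('a) t u \<longleftrightarrow>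
     (\<forall>(M :: 'a sasaki) \<nu>. sasaki_model M \<nu> \<longrightarrow> interp M \<nu> t \<sqsubseteq>\<^bsub>M\<^esub> interp M \<nu> u)"

definition SOL :: "'p trm \<Rightarrow> 'p trm \<Rightarrow> bool" (\<open>\<turnstile>\<^bsub>SOL\<^esub> _ \<preceq> _\<close> [51, 51] 50) where
  "\<turnstile>\<^bsub>SOL\<^esub> t \<preceq> u \<longleftrightarrow> valid_in TYPE('p trm set) t u"


section \<open>The calculus\<close>

inductive RSOL :: "'p trm \<Rightarrow> 'p trm \<Rightarrow> bool" (\<open>\<turnstile>\<^bsub>RSOL\<^esub> _ \<preceq> _\<close> [51, 51] 50) where
  A: "\<turnstile>\<^bsub>RSOL\<^esub> a \<preceq> a"
| S: "\<turnstile>\<^bsub>RSOL\<^esub> b\<^sup>\<bottom> \<preceq> a\<^sup>\<bottom> \<Longrightarrow> \<turnstile>\<^bsub>RSOL\<^esub> a \<preceq> b"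
| G: "\<turnstile>\<^bsub>RSOL\<^esub> c\<^sup>\<bottom> \<^bold>& b \<preceq> a\<^sup>\<bottom> \<Longrightarrow> \<turnstile>\<^bsub>RSOL\<^esub> a \<^bold>& b \<preceq> c"
| N_L: "\<turnstile>\<^bsub>RSOL\<^esub> a \<preceq> b \<Longrightarrow> \<turnstile>\<^bsub>RSOL\<^esub> a\<^sup>\<bottom>\<^sup>\<bottom> \<preceq> b"
| N_R: "\<turnstile>\<^bsub>RSOL\<^esub> a \<preceq> b \<Longrightarrow> \<turnstile>\<^bsub>RSOL\<^esub> a \<preceq> b\<^sup>\<bottom>\<^sup>\<bottom>"
| T: "\<lbrakk>\<turnstile>\<^bsub>RSOL\<^esub> a \<preceq> b; \<turnstile>\<^bsub>RSOL\<^esub> b \<preceq> c\<rbrakk> \<Longrightarrow> \<turnstile>\<^bsub>RSOL\<^esub> a \<preceq> c"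
| O_L: "\<lbrakk>\<turnstile>\<^bsub>RSOL\<^esub> a \<preceq> b; \<turnstile>\<^bsub>RSOL\<^esub> a \<preceq> c\<rbrakk> \<Longrightarrow> \<turnstile>\<^bsub>RSOL\<^esub> a \<^bold>& b \<preceq> c"
| O_R: "\<lbrakk>\<turnstile>\<^bsub>RSOL\<^esub> a \<preceq> b; \<turnstile>\<^bsub>RSOL\<^esub> a \<preceq> c\<rbrakk> \<Longrightarrow> \<turnstile>\<^bsub>RSOL\<^esub> a \<preceq> b \<^bold>& c"
| R: "\<turnstile>\<^bsub>RSOL\<^esub> b \<preceq> c \<Longrightarrow> \<turnstile>\<^bsub>RSOL\<^esub> a \<^bold>& b \<preceq> c"
| M: "\<lbrakk>\<turnstile>\<^bsub>RSOL\<^esub> a \<preceq> c; \<turnstile>\<^bsub>RSOL\<^esub> b \<preceq> d; \<turnstile>\<^bsub>RSOL\<^esub> d \<preceq> b\<rbrakk> \<Longrightarrow> \<turnstile>\<^bsub>RSOL\<^esub> a \<^bold>& b \<preceq> c \<^bold>& d"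


section \<open>Independence of the type of models\<close>

lemma interp_closed:
  assumes "sasaki_model M \<nu>"
  shows "interp M \<nu> t \<in> carrier M"
proof -
  interpret sasaki_orthoposet M using assms by (simp add: sasaki_model_def)
  show ?thesis
    using assms by (induction t) (auto simp: sasaki_model_def perp_closed sand_closed)
qed

lemma (in sasaki_orthoposet) sand_perp_le:
  assumes a: "a \<in> carrier L" and c: "c \<in> carrier L"
  shows "a \<odot> \<sim> a \<sqsubseteq> c"
proof -
  have "\<sim> c \<odot> \<sim> a \<sqsubseteq> \<sim> a"
    using a c by (simp add: R_Reduction perp_closed)
  from Galois[OF _ _ _ this] show ?thesis
    using a c by (simp add: perp_closed perp_perp)
qed

text \<open>
  The values of the terms form a Sasaki orthoposet, which is copied to the type
  \<^typ>\<open>'p trm set\<close> by sending each value to the set of the terms denoting it.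
\<close>

lemma sasaki_model_transfer:
  fixes M :: "'a sasaki" and \<nu> :: "'p \<Rightarrow> 'a"
  assumes model: "sasaki_model M \<nu>"
  obtains N :: "'p trm set sasaki" and \<mu> where "sasaki_model N \<mu>"
    and "\<And>t u. interp N \<mu> t \<sqsubseteq>\<^bsub>N\<^esub> interp N \<mu> u \<longleftrightarrow> interp M \<nu> t \<sqsubseteq>\<^bsub>M\<^esub> interp M \<nu> u"
proof -
  interpret M: sasaki_orthoposet M using model by (simp add: sasaki_model_def)
  define I where "I = interp M \<nu>"
  define cls where "cls t = {s. I s = I t}" for t
  define rep where "rep C = (SOME t. t \<in> C)" for C :: "'p trm set"
  define N :: "'p trm set sasaki" where "N = \<lparr>carrier = range cls, eq = (=), le = (\<lambda>C D. I (rep C) \<sqsubseteq>\<^bsub>M\<^esub> I (rep D)),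
    perp = (\<lambda>C. cls ((rep C)\<^sup>\<bottom>)), sand = (\<lambda>C D. cls (rep C \<^bold>& rep D))\<rparr>"
  have I_closed [simp]: "I t \<in> carrier M" for t
    unfolding I_def by (rule interp_closed[OF model])
  have I_simps: "I (t \<^bold>& u) = I t \<odot>\<^bsub>M\<^esub> I u" "I (t\<^sup>\<bottom>) = \<sim>\<^bsub>M\<^esub> (I t)" for t u
    by (simp_all add: I_def)
  have cls_eq: "cls t = cls u \<longleftrightarrow> I t = I u" for t u
    unfolding cls_def by auto
  have I_rep [simp]: "I (rep (cls t)) = I t" for t
    unfolding rep_def cls_def by (rule someI2[of _ t]) auto
  have le_N: "cls t \<sqsubseteq>\<^bsub>N\<^esub> cls u \<longleftrightarrow> I t \<sqsubseteq>\<^bsub>M\<^esub> I u" for t u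
    by (simp add: N_def)
  have perp_N: "\<sim>\<^bsub>N\<^esub> (cls t) = cls (t\<^sup>\<bottom>)" for t
    by (simp add: N_def cls_eq I_simps)
  have sand_N: "cls t \<odot>\<^bsub>N\<^esub> cls u = cls (t \<^bold>& u)" for t u
    by (simp add: N_def cls_eq I_simps)
  have carrier_N: "carrier N = range cls" and eq_N: "(.=\<^bsub>N\<^esub>) = (=)"
    by (simp_all add: N_def)
  have antisym: "I t \<sqsubseteq>\<^bsub>M\<^esub> I u \<Longrightarrow> I u \<sqsubseteq>\<^bsub>M\<^esub> I t \<Longrightarrow> cls t = cls u" for t u
    unfolding cls_eq by (rule M.le_antisym) auto
  have le_trans: "I s \<sqsubseteq>\<^bsub>M\<^esub> I t \<Longrightarrow> I t \<sqsubseteq>\<^bsub>M\<^esub> I u \<Longrightarrow> I s \<sqsubseteq>\<^bsub>M\<^esub> I u" for s t u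
    by (rule M.le_trans) auto
  have bot_le: "I (t \<^bold>& t\<^sup>\<bottom>) \<sqsubseteq>\<^bsub>M\<^esub> I u" for t u
    using M.sand_perp_le[of "I t" "I u"] by (simp add: I_simps)
  have anti: "I (u\<^sup>\<bottom>) \<sqsubseteq>\<^bsub>M\<^esub> I (t\<^sup>\<bottom>)" if "I t \<sqsubseteq>\<^bsub>M\<^esub> I u" for t u
    using M.perp_antimono[OF _ _ that] by (simp add: I_simps)
  have inv: "I (t\<^sup>\<bottom>\<^sup>\<bottom>) = I t" for t by (simp add: I_simps M.perp_perp)
  have top_ge: "I u \<sqsubseteq>\<^bsub>M\<^esub> I ((t \<^bold>& t\<^sup>\<bottom>)\<^sup>\<bottom>)" for t u
    using anti[OF bot_le[of t "u\<^sup>\<bottom>"]] by (simp add: inv)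
  have least: "least N (cls (t \<^bold>& t\<^sup>\<bottom>)) (carrier N)" for t
    by (auto simp: least_def carrier_N le_N bot_le)
  have greatest: "greatest N (cls ((t \<^bold>& t\<^sup>\<bottom>)\<^sup>\<bottom>)) (carrier N)" for t
    by (auto simp: greatest_def carrier_N le_N top_ge)
  interpret N: partial_order N
  proof
    fix a b assume "a \<sqsubseteq>\<^bsub>N\<^esub> b" "b \<sqsubseteq>\<^bsub>N\<^esub> a" "a \<in> carrier N" "b \<in> carrier N"
    then show "a .=\<^bsub>N\<^esub> b"
      unfolding eq_N carrier_N by (elim imageE) (simp only: le_N, rule antisym)
  next
    fix a b c assume "a \<sqsubseteq>\<^bsub>N\<^esub> b" "b \<sqsubseteq>\<^bsub>N\<^esub> c"
      "a \<in> carrier N" "b \<in> carrier N" "c \<in> carrier N"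
    then show "a \<sqsubseteq>\<^bsub>N\<^esub> c"
      unfolding carrier_N by (elim imageE) (simp only: le_N, rule le_trans)
  next
    fix a assume "a \<in> carrier N"
    then show "a \<sqsubseteq>\<^bsub>N\<^esub> a"
      unfolding carrier_N by (elim imageE) (simp add: le_N)
  qed (simp_all add: eq_N)
  interpret N: weak_partial_order_bottom N
    by unfold_locales (rule exI, rule least)
  interpret N: weak_partial_order_top N
    by unfold_locales (rule exI, rule greatest)
  have bottom: "\<bottom>\<^bsub>N\<^esub> = cls (t \<^bold>& t\<^sup>\<bottom>)" for t
    using N.least_unique[OF N.bottom_least least] .
  have top: "\<top>\<^bsub>N\<^esub> = cls ((t \<^bold>& t\<^sup>\<bottom>)\<^sup>\<bottom>)" for t
    using N.greatest_unique[OF N.top_greatest greatest] .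
  have meet: "I s \<sqsubseteq>\<^bsub>M\<^esub> I (t \<^bold>& t\<^sup>\<bottom>)" if "I s \<sqsubseteq>\<^bsub>M\<^esub> I t" "I s \<sqsubseteq>\<^bsub>M\<^esub> I (t\<^sup>\<bottom>)" for s t
  proof -
    have "I s = I s \<odot>\<^bsub>M\<^esub> I (t\<^sup>\<bottom>)" using that by (intro M.Orthomodularity) auto
    moreover have "I s \<odot>\<^bsub>M\<^esub> I (t\<^sup>\<bottom>) \<sqsubseteq>\<^bsub>M\<^esub> I t \<odot>\<^bsub>M\<^esub> I (t\<^sup>\<bottom>)"
      using that by (intro M.L_Monotony) auto
    ultimately show ?thesis by (simp add: I_simps)
  qed
  have join: "I ((t \<^bold>& t\<^sup>\<bottom>)\<^sup>\<bottom>) \<sqsubseteq>\<^bsub>M\<^esub> I s" if "I t \<sqsubseteq>\<^bsub>M\<^esub> I s" "I (t\<^sup>\<bottom>) \<sqsubseteq>\<^bsub>M\<^esub> I s" for s t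
  proof -
    have "I (s\<^sup>\<bottom>) \<sqsubseteq>\<^bsub>M\<^esub> I (t \<^bold>& t\<^sup>\<bottom>)"
      using anti[OF that(1)] anti[OF that(2)] by (intro meet) (simp_all add: inv)
    from anti[OF this] show ?thesis by (simp add: inv)
  qed
  have glb: "is_glb N \<bottom>\<^bsub>N\<^esub> {cls t, \<sim>\<^bsub>N\<^esub> (cls t)}" for t
    unfolding perp_N bottom[of t]
    by (rule greatest_LowerI)
      (auto simp: carrier_N le_N bot_le Lower_def intro!: meet)
  have lub: "is_lub N \<top>\<^bsub>N\<^esub> {cls t, \<sim>\<^bsub>N\<^esub> (cls t)}" for t
    unfolding perp_N top[of t]
    by (rule least_UpperI)
      (auto simp: carrier_N le_N top_ge Upper_def intro!: join)
  have N_cases: "\<exists>t. a = cls t" if "a \<in> carrier N" for a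
    using that by (auto simp: carrier_N)
  interpret N: bounded_orthoposet N
  proof
    fix a assume "a \<in> carrier N"
    then obtain t where t: "a = cls t" using N_cases by blast
    show "\<sim>\<^bsub>N\<^esub> a \<in> carrier N" "\<sim>\<^bsub>N\<^esub> (\<sim>\<^bsub>N\<^esub> a) = a"
      by (simp_all add: t carrier_N perp_N cls_eq inv)
    show "is_glb N \<bottom>\<^bsub>N\<^esub> {a, \<sim>\<^bsub>N\<^esub> a}" "is_lub N \<top>\<^bsub>N\<^esub> {a, \<sim>\<^bsub>N\<^esub> a}"
      unfolding t by (rule glb, rule lub)
    fix b assume "b \<in> carrier N"
    then obtain u where u: "b = cls u" using N_cases by blast
    show "\<sim>\<^bsub>N\<^esub> b \<sqsubseteq>\<^bsub>N\<^esub> \<sim>\<^bsub>N\<^esub> a" if "a \<sqsubseteq>\<^bsub>N\<^esub> b"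
      using that unfolding t u perp_N le_N by (rule anti)
  qed
  have "sasaki_orthoposet N"
  proof
    fix a b assume "a \<in> carrier N" "b \<in> carrier N"
    then obtain t u where tu: "a = cls t" "b = cls u" using N_cases by metis
    show "a \<odot>\<^bsub>N\<^esub> b \<in> carrier N" by (simp add: tu carrier_N sand_N)
    show "a \<odot>\<^bsub>N\<^esub> b \<sqsubseteq>\<^bsub>N\<^esub> b" by (simp add: tu sand_N le_N I_simps M.R_Reduction)
    show "a = a \<odot>\<^bsub>N\<^esub> b" if "a \<sqsubseteq>\<^bsub>N\<^esub> b"
      using that unfolding tu sand_N le_N cls_eq I_simps by (intro M.Orthomodularity) simp_all
    fix c assume "c \<in> carrier N"
    then obtain v where v: "c = cls v" using N_cases by blast
    show "a \<odot>\<^bsub>N\<^esub> c \<sqsubseteq>\<^bsub>N\<^esub> b \<odot>\<^bsub>N\<^esub> c" if "a \<sqsubseteq>\<^bsub>N\<^esub> b"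
      using that unfolding tu v sand_N le_N I_simps by (intro M.L_Monotony) simp_all
    show "\<sim>\<^bsub>N\<^esub> c \<odot>\<^bsub>N\<^esub> b \<sqsubseteq>\<^bsub>N\<^esub> \<sim>\<^bsub>N\<^esub> a" if "a \<odot>\<^bsub>N\<^esub> b \<sqsubseteq>\<^bsub>N\<^esub> c"
      using that unfolding tu v sand_N perp_N le_N I_simps by (intro M.Galois) simp_all
  qed
  then have "sasaki_model N (\<lambda>p. cls (Atom p))"
    by (simp add: sasaki_model_def carrier_N)
  moreover have "interp N (\<lambda>p. cls (Atom p)) t = cls t" for t
    by (induction t) (simp_all add: sand_N perp_N)
  ultimately show ?thesis
    using le_N that unfolding I_def by metis
qed

theorem SOL_valid_in_all_types:
  fixes t u :: "'p trm"
  assumes "\<turnstile>\<^bsub>SOL\<^esub> t \<preceq> u"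
  shows "valid_in TYPE('a) t u"
  unfolding valid_in_def
proof (intro allI impI)
  fix M :: "'a sasaki" and \<nu> :: "'p \<Rightarrow> 'a"
  assume "sasaki_model M \<nu>"
  then obtain N :: "'p trm set sasaki" and \<mu> where "sasaki_model N \<mu>"
    and iff: "\<And>t u. interp N \<mu> t \<sqsubseteq>\<^bsub>N\<^esub> interp N \<mu> u \<longleftrightarrow> interp M \<nu> t \<sqsubseteq>\<^bsub>M\<^esub> interp M \<nu> u"
    using sasaki_model_transfer by blast
  then have "interp N \<mu> t \<sqsubseteq>\<^bsub>N\<^esub> interp N \<mu> u"
    using assms unfolding SOL_def valid_in_def by blast
  then show "interp M \<nu> t \<sqsubseteq>\<^bsub>M\<^esub> interp M \<nu> u"
    by (simp add: iff)
qed

end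

theory Submission
  imports Defs
begin

text \<open>
  The Lindenbaum algebra: terms modulo mutual derivability form a Sasaki orthoposet in
  which the class of \<open>t\<close> lies below the class of \<open>u\<close> exactly if \<open>t \<preceq> u\<close> is derivable, and
  each term denotes its own class. A valid inequality is therefore derivable. The least
  element is the class of \<open>t \<^bold>& t\<^sup>\<bottom>\<close>, for any \<open>t\<close>.
\<close>

text \<open>\<open>S\<close> only reflects the order through complements. Applied to two complements
  it asks for \<open>a\<^sup>\<bottom>\<^sup>\<bottom>\<close> below
  \<open>b\<^sup>\<bottom>\<^sup>\<bottom>\<close>, which \<open>N_R\<close> and \<open>N_L\<close>
  reduce to the hypothesis.\<close>

lemma RSOL_perp_antimono:
  assumes "\<turnstile>\<^bsub>RSOL\<^esub> a \<preceq> b"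
  shows "\<turnstile>\<^bsub>RSOL\<^esub> b\<^sup>\<bottom> \<preceq> a\<^sup>\<bottom>"
  by (rule S, rule N_R, rule N_L, rule assms)

text \<open>Converse of \<open>G\<close>, obtained from \<open>G\<close> itself up to double
  complements. The one on the right goes by \<open>N_R\<close>; the one inside the conjunction is
  out of reach of \<open>N_L\<close>, so \<open>M\<close> replaces
  \<open>a\<^sup>\<bottom>\<^sup>\<bottom>\<close> by \<open>a\<close> there.\<close>

lemma RSOL_Galois:
  assumes "\<turnstile>\<^bsub>RSOL\<^esub> a \<^bold>& b \<preceq> c"
  shows "\<turnstile>\<^bsub>RSOL\<^esub> c\<^sup>\<bottom> \<^bold>& b \<preceq> a\<^sup>\<bottom>"
proof (rule G, rule N_R, rule T)
  show "\<turnstile>\<^bsub>RSOL\<^esub> a\<^sup>\<bottom>\<^sup>\<bottom> \<^bold>& b \<preceq> a \<^bold>& b"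
    by (intro M N_L A)
qed (rule assms)

text \<open>\<open>G\<close> reduces this to an instance of \<open>R\<close> whose right conjunct is
  \<open>t\<^sup>\<bottom>\<close>. It provides the least element, for which the language has no
  constant.\<close>

lemma RSOL_sand_perp_le: "\<turnstile>\<^bsub>RSOL\<^esub> t \<^bold>& t\<^sup>\<bottom> \<preceq> u"
  by (rule G, rule R, rule A)

text \<open>Needed for the meet of \<open>t\<close> and \<open>t\<^sup>\<bottom>\<close> to be the
  least element: a term below \<open>t\<^sup>\<bottom>\<close> is absorbed by conjunction with it,
  and monotony on the left then replaces \<open>s\<close> by \<open>t\<close>.\<close>

lemma RSOL_le_sand_perp:
  assumes "\<turnstile>\<^bsub>RSOL\<^esub> s \<preceq> t" and "\<turnstile>\<^bsub>RSOL\<^esub> s \<preceq> t\<^sup>\<bottom>"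
  shows "\<turnstile>\<^bsub>RSOL\<^esub> s \<preceq> t \<^bold>& t\<^sup>\<bottom>"
proof (rule T)
  show "\<turnstile>\<^bsub>RSOL\<^esub> s \<preceq> s \<^bold>& t\<^sup>\<bottom>"
    by (intro O_R A assms(2))
  show "\<turnstile>\<^bsub>RSOL\<^esub> s \<^bold>& t\<^sup>\<bottom> \<preceq> t \<^bold>& t\<^sup>\<bottom>"
    by (intro M A assms(1))
qed

lemma RSOL_le_perp_sand_perp: "\<turnstile>\<^bsub>RSOL\<^esub> u \<preceq> (t \<^bold>& t\<^sup>\<bottom>)\<^sup>\<bottom>"
  by (rule S, rule N_L, rule RSOL_sand_perp_le)

text \<open>Dual of \<open>RSOL_le_sand_perp\<close>, applied to \<open>s\<^sup>\<bottom>\<close>: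
  common upper bounds become common lower bounds under complementation.\<close>

lemma RSOL_perp_sand_perp_le:
  assumes "\<turnstile>\<^bsub>RSOL\<^esub> t \<preceq> s" and "\<turnstile>\<^bsub>RSOL\<^esub> t\<^sup>\<bottom> \<preceq> s"
  shows "\<turnstile>\<^bsub>RSOL\<^esub> (t \<^bold>& t\<^sup>\<bottom>)\<^sup>\<bottom> \<preceq> s"
proof (rule S, rule N_R, rule RSOL_le_sand_perp)
  show "\<turnstile>\<^bsub>RSOL\<^esub> s\<^sup>\<bottom> \<preceq> t"
    by (rule S, rule N_R, rule assms(2))
  show "\<turnstile>\<^bsub>RSOL\<^esub> s\<^sup>\<bottom> \<preceq> t\<^sup>\<bottom>"
    by (rule RSOL_perp_antimono, rule assms(1))
qed

definition RSOL_class :: "'p trm \<Rightarrow> 'p trm set" where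
  "RSOL_class t = {s. \<turnstile>\<^bsub>RSOL\<^esub> s \<preceq> t \<and> \<turnstile>\<^bsub>RSOL\<^esub> t \<preceq> s}"

lemma RSOL_class_self: "t \<in> RSOL_class t"
  by (simp add: RSOL_class_def A)

lemma RSOL_class_nonempty: "RSOL_class t \<noteq> {}"
  using RSOL_class_self[of t] by blast

lemma RSOL_class_eq_iff:
  "RSOL_class t = RSOL_class u \<longleftrightarrow> \<turnstile>\<^bsub>RSOL\<^esub> t \<preceq> u \<and> \<turnstile>\<^bsub>RSOL\<^esub> u \<preceq> t"
proof
  assume "RSOL_class t = RSOL_class u"
  with RSOL_class_self[of t] have "t \<in> RSOL_class u"
    by simp
  then show "\<turnstile>\<^bsub>RSOL\<^esub> t \<preceq> u \<and> \<turnstile>\<^bsub>RSOL\<^esub> u \<preceq> t"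
    by (simp add: RSOL_class_def)
next
  assume "\<turnstile>\<^bsub>RSOL\<^esub> t \<preceq> u \<and> \<turnstile>\<^bsub>RSOL\<^esub> u \<preceq> t"
  then show "RSOL_class t = RSOL_class u"
    unfolding RSOL_class_def by (meson T)
qed

text \<open>No representatives are chosen: an operation unites the results over all of them. On
  classes these results coincide, so the union is again a single class.\<close>

definition lindenbaum :: "'p trm set sasaki" where
  "lindenbaum =
     \<lparr>carrier = range RSOL_class, eq = (=),
      le = (\<lambda>C D. \<exists>t\<in>C. \<exists>u\<in>D. \<turnstile>\<^bsub>RSOL\<^esub> t \<preceq> u),
      perp = (\<lambda>C. \<Union>t\<in>C. RSOL_class (t\<^sup>\<bottom>)),
      sand = (\<lambda>C D. \<Union>t\<in>C. \<Union>u\<in>D. RSOL_class (t \<^bold>& u))\<rparr>"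

lemma carrier_lindenbaum: "carrier lindenbaum = range RSOL_class"
  and eq_lindenbaum: "(.=\<^bsub>lindenbaum\<^esub>) = (=)"
  by (simp_all add: lindenbaum_def)

lemma le_lindenbaum:
  "RSOL_class t \<sqsubseteq>\<^bsub>lindenbaum\<^esub> RSOL_class u \<longleftrightarrow> \<turnstile>\<^bsub>RSOL\<^esub> t \<preceq> u"
proof
  assume "RSOL_class t \<sqsubseteq>\<^bsub>lindenbaum\<^esub> RSOL_class u"
  then obtain s v where "\<turnstile>\<^bsub>RSOL\<^esub> t \<preceq> s" "\<turnstile>\<^bsub>RSOL\<^esub> s \<preceq> v" "\<turnstile>\<^bsub>RSOL\<^esub> v \<preceq> u"
    by (auto simp: lindenbaum_def RSOL_class_def)
  then show "\<turnstile>\<^bsub>RSOL\<^esub> t \<preceq> u"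
    by (meson T)
next
  assume "\<turnstile>\<^bsub>RSOL\<^esub> t \<preceq> u"
  then show "RSOL_class t \<sqsubseteq>\<^bsub>lindenbaum\<^esub> RSOL_class u"
    by (auto simp: lindenbaum_def RSOL_class_def intro: A)
qed

lemma perp_lindenbaum: "\<sim>\<^bsub>lindenbaum\<^esub> (RSOL_class t) = RSOL_class (t\<^sup>\<bottom>)"
proof -
  have "(\<Union>s\<in>RSOL_class t. RSOL_class (s\<^sup>\<bottom>)) = RSOL_class (t\<^sup>\<bottom>)"
  proof (intro SUP_eq_const RSOL_class_nonempty)
    fix s assume "s \<in> RSOL_class t"
    then show "RSOL_class (s\<^sup>\<bottom>) = RSOL_class (t\<^sup>\<bottom>)"
      unfolding RSOL_class_eq_iff by (simp add: RSOL_class_def RSOL_perp_antimono)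
  qed
  then show ?thesis
    by (simp add: lindenbaum_def)
qed

text \<open>Conjunction respects equivalence by \<open>M\<close>, whose premises ask for the right
  conjuncts to be equivalent and not merely comparable; membership in a class gives both
  directions.\<close>

lemma sand_lindenbaum:
  "RSOL_class t \<odot>\<^bsub>lindenbaum\<^esub> RSOL_class u = RSOL_class (t \<^bold>& u)"
proof -
  have "(\<Union>s\<in>RSOL_class t. \<Union>v\<in>RSOL_class u. RSOL_class (s \<^bold>& v)) = RSOL_class (t \<^bold>& u)"
  proof (intro SUP_eq_const RSOL_class_nonempty)
    fix s v assume "s \<in> RSOL_class t" "v \<in> RSOL_class u"
    then show "RSOL_class (s \<^bold>& v) = RSOL_class (t \<^bold>& u)"
      unfolding RSOL_class_eq_iff by (simp add: RSOL_class_def M)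
  qed
  then show ?thesis
    by (simp add: lindenbaum_def)
qed

lemma lindenbaum_cases:
  assumes "a \<in> carrier lindenbaum"
  obtains t where "a = RSOL_class t"
  using assms by (auto simp: carrier_lindenbaum)

lemma partial_order_lindenbaum: "partial_order lindenbaum"
proof
  fix a b c :: "'a trm set"
  assume "a \<in> carrier lindenbaum" "b \<in> carrier lindenbaum" "c \<in> carrier lindenbaum"
    "a \<sqsubseteq>\<^bsub>lindenbaum\<^esub> b" "b \<sqsubseteq>\<^bsub>lindenbaum\<^esub> c"
  then show "a \<sqsubseteq>\<^bsub>lindenbaum\<^esub> c"
    by (elim lindenbaum_cases) (simp only: le_lindenbaum, rule T)
next
  fix a b :: "'a trm set"
  assume "a \<in> carrier lindenbaum" "b \<in> carrier lindenbaum"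
    "a \<sqsubseteq>\<^bsub>lindenbaum\<^esub> b" "b \<sqsubseteq>\<^bsub>lindenbaum\<^esub> a"
  then show "a .=\<^bsub>lindenbaum\<^esub> b"
    unfolding eq_lindenbaum
    by (elim lindenbaum_cases) (simp add: le_lindenbaum RSOL_class_eq_iff)
next
  fix a :: "'a trm set"
  assume "a \<in> carrier lindenbaum"
  then show "a \<sqsubseteq>\<^bsub>lindenbaum\<^esub> a"
    by (elim lindenbaum_cases) (simp add: le_lindenbaum A)
qed (simp_all add: eq_lindenbaum)

lemma least_lindenbaum: "least lindenbaum (RSOL_class (t \<^bold>& t\<^sup>\<bottom>)) (carrier lindenbaum)"
  by (auto simp: least_def carrier_lindenbaum le_lindenbaum RSOL_sand_perp_le)

lemma greatest_lindenbaum: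
  "greatest lindenbaum (RSOL_class ((t \<^bold>& t\<^sup>\<bottom>)\<^sup>\<bottom>)) (carrier lindenbaum)"
  by (auto simp: greatest_def carrier_lindenbaum le_lindenbaum RSOL_le_perp_sand_perp)

lemma bounded_orthoposet_lindenbaum: "bounded_orthoposet (lindenbaum :: 'p trm set sasaki)"
proof -
  let ?L = "lindenbaum :: 'p trm set sasaki"
  interpret partial_order ?L
    by (rule partial_order_lindenbaum)
  interpret weak_partial_order_bottom ?L
    by unfold_locales (rule exI, rule least_lindenbaum)
  interpret weak_partial_order_top ?L
    by unfold_locales (rule exI, rule greatest_lindenbaum)
  show ?thesis
  proof
    fix a assume "a \<in> carrier ?L"
    then obtain t where t: "a = RSOL_class t" by (rule lindenbaum_cases)
    show "\<sim>\<^bsub>?L\<^esub> a \<in> carrier ?L"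
      by (simp add: t perp_lindenbaum carrier_lindenbaum)
    show "\<sim>\<^bsub>?L\<^esub> (\<sim>\<^bsub>?L\<^esub> a) = a"
      by (simp add: t perp_lindenbaum RSOL_class_eq_iff A N_L N_R)
    \<comment> \<open>The least element is unique, so it may be represented through the very
      \<open>t\<close> that represents \<open>a\<close>; the facts on \<open>t\<close> and
      \<open>t\<^sup>\<bottom>\<close> then apply to the meet. The greatest element is treated alike
      for the join.\<close>
    have bottom: "\<bottom>\<^bsub>?L\<^esub> = RSOL_class (t \<^bold>& t\<^sup>\<bottom>)"
      using least_unique[OF bottom_least least_lindenbaum] .
    show "is_glb ?L \<bottom>\<^bsub>?L\<^esub> {a, \<sim>\<^bsub>?L\<^esub> a}"
      unfolding t perp_lindenbaum bottom
      by (rule greatest_LowerI)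
        (auto simp: carrier_lindenbaum le_lindenbaum RSOL_sand_perp_le Lower_def
          intro!: RSOL_le_sand_perp)
    have top: "\<top>\<^bsub>?L\<^esub> = RSOL_class ((t \<^bold>& t\<^sup>\<bottom>)\<^sup>\<bottom>)"
      using greatest_unique[OF top_greatest greatest_lindenbaum] .
    show "is_lub ?L \<top>\<^bsub>?L\<^esub> {a, \<sim>\<^bsub>?L\<^esub> a}"
      unfolding t perp_lindenbaum top
      by (rule least_UpperI)
        (auto simp: carrier_lindenbaum le_lindenbaum RSOL_le_perp_sand_perp Upper_def
          intro!: RSOL_perp_sand_perp_le)
    fix b assume "b \<in> carrier ?L"
    then obtain u where u: "b = RSOL_class u" by (rule lindenbaum_cases)
    show "\<sim>\<^bsub>?L\<^esub> b \<sqsubseteq>\<^bsub>?L\<^esub> \<sim>\<^bsub>?L\<^esub> a" if "a \<sqsubseteq>\<^bsub>?L\<^esub> b"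
      using that unfolding t u perp_lindenbaum le_lindenbaum by (rule RSOL_perp_antimono)
  qed
qed

text \<open>Axioms match rules: \<open>R\<close> gives R-Reduction, \<open>O_L\<close> and
  \<open>O_R\<close> the two halves of Orthomodularity, \<open>M\<close> L-Monotony, and
  \<open>RSOL_Galois\<close> the Galois law.\<close>

lemma sasaki_orthoposet_lindenbaum: "sasaki_orthoposet (lindenbaum :: 'p trm set sasaki)"
proof -
  let ?L = "lindenbaum :: 'p trm set sasaki"
  interpret bounded_orthoposet ?L
    by (rule bounded_orthoposet_lindenbaum)
  show ?thesis
  proof
    fix a b assume "a \<in> carrier ?L" "b \<in> carrier ?L"
    then obtain t u where tu: "a = RSOL_class t" "b = RSOL_class u"
      by (elim lindenbaum_cases)
    show "a \<odot>\<^bsub>?L\<^esub> b \<in> carrier ?L"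
      by (simp add: tu sand_lindenbaum carrier_lindenbaum)
    show "a \<odot>\<^bsub>?L\<^esub> b \<sqsubseteq>\<^bsub>?L\<^esub> b"
      by (simp add: tu sand_lindenbaum le_lindenbaum A R)
    show "a = a \<odot>\<^bsub>?L\<^esub> b" if "a \<sqsubseteq>\<^bsub>?L\<^esub> b"
      using that by (simp add: tu sand_lindenbaum le_lindenbaum RSOL_class_eq_iff A O_L O_R)
    fix c assume "c \<in> carrier ?L"
    then obtain v where v: "c = RSOL_class v" by (rule lindenbaum_cases)
    show "a \<odot>\<^bsub>?L\<^esub> c \<sqsubseteq>\<^bsub>?L\<^esub> b \<odot>\<^bsub>?L\<^esub> c" if "a \<sqsubseteq>\<^bsub>?L\<^esub> b"
      using that by (simp add: tu v sand_lindenbaum le_lindenbaum A M)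
    show "\<sim>\<^bsub>?L\<^esub> c \<odot>\<^bsub>?L\<^esub> b \<sqsubseteq>\<^bsub>?L\<^esub> \<sim>\<^bsub>?L\<^esub> a" if "a \<odot>\<^bsub>?L\<^esub> b \<sqsubseteq>\<^bsub>?L\<^esub> c"
      using that by (simp add: tu v sand_lindenbaum perp_lindenbaum le_lindenbaum RSOL_Galois)
  qed
qed

lemma interp_lindenbaum: "interp lindenbaum (\<lambda>p. RSOL_class (Atom p)) t = RSOL_class t"
  by (induction t) (simp_all add: sand_lindenbaum perp_lindenbaum)

theorem proposition9:
  fixes t u :: "'p trm"
  assumes "\<turnstile>\<^bsub>SOL\<^esub> t \<preceq> u"
  shows "\<turnstile>\<^bsub>RSOL\<^esub> t \<preceq> u"
proof -
  have "sasaki_model lindenbaum (\<lambda>p :: 'p. RSOL_class (Atom p))"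
    by (simp add: sasaki_model_def sasaki_orthoposet_lindenbaum carrier_lindenbaum)
  \<comment> \<open>The classes have type \<open>'p trm set\<close>, the type of models over which
    \<open>SOL\<close> quantifies, so validity specializes directly to this model.\<close>
  then have "interp lindenbaum (\<lambda>p. RSOL_class (Atom p)) t
      \<sqsubseteq>\<^bsub>lindenbaum\<^esub> interp lindenbaum (\<lambda>p. RSOL_class (Atom p)) u"
    using assms unfolding SOL_def valid_in_def by blast
  then show ?thesis
    by (simp add: interp_lindenbaum le_lindenbaum)
qed

end
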